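(* Consider an A-cube $(x_1,\dots,x_4,\tilde x_1,\dots,\tilde x_4)$ with opposite faces $(x_1,x_2,x_3,x_4)$ and $(\tilde x_1,\tilde x_2,\tilde x_3,\tilde x_4)$. Propagation of a cross $(p_{12},p_{23},p_{34},p_{41})$ attached to the quadrilateral $(x_1,x_2,x_3,x_4)$ according to the $C^1$-condition around horizontal edges (as defined in the context) yields a unique cross $(\tilde p_{12},\tilde p_{23},\tilde p_{34},\tilde p_{41})$ attached to the quadrilateral $(\tilde x_1,\tilde x_2,\tilde x_3,\tilde x_4)$. The centres $q$ and $\tilde q$ of the crosses $(p_{12},p_{23},p_{34},p_{41})$ and $(\tilde p_{12},\tilde p_{23},\tilde p_{34},\tilde p_{41})$ satisfy the Weingarten property, i.e., $$\operatorname{inc}[q,\tilde q]=\operatorname{inc}[p_{12},p_{23},p_{34},p_{41}]\cap\operatorname{inc}[\tilde p_{12},\tilde p_{23},\tilde p_{34},\tilde p_{41}].$$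
   Context: All points lie in $\mathbb{R}^3$, regarded as the affine part of $\mathbb{R}\mathrm{P}^3$; intersection points are allowed to be at infinity. $\operatorname{inc}[y_1,\dots,y_n]$ denotes the subspace (line, plane) spanned by the points $y_1,\dots,y_n$. An A-cube is an elementary hexahedron of a (generic) discrete A-net, i.e. a combinatorial cube with vertices $x_1,\dots,x_4,\tilde x_1,\dots,\tilde x_4$ and faces $(x_1,x_2,x_3,x_4)$, $(\tilde x_1,\tilde x_2,\tilde x_3,\tilde x_4)$ and $(x_i,x_{i+1},\tilde x_{i+1},\tilde x_i)$ (indices modulo 4), such that every face is a skew quadrilateral (its four vertices are not coplanar) and every vertex star is planar: each vertex is coplanar with its three neighbours. Genericity means that the quadrilaterals are skew and each vertex star defines a unique plane. The horizontal edges are the edges of the two faces $(x_1,x_2,x_3,x_4)$ and $(\tilde x_1,\tilde x_2,\tilde x_3,\tilde x_4)$. A cross attached to a skew quadrilateral $(x_1,x_2,x_3,x_4)$ is a quadruple of coplanar points $p_{12},p_{23},p_{34},p_{41}$, with $p_{ij}$ on the line $\operatorname{inc}[x_i,x_j]$ (extended edge) and different from $x_i,x_j$. These points are the cross vertices; the centre of the cross is the intersection point $\operatorname{inc}[p_{12},p_{34}]\cap\operatorname{inc}[p_{23},p_{41}]$ of the two crossing lines. Propagation according to the $C^1$-condition around horizontal edges: for each cyclic choice $(i,j,k,l)$ of $(1,2,3,4)$ (i.e. $(j,k,l)=(i+1,i+2,i+3)$ modulo 4), the point $\tilde p_{kl}$ on $\operatorname{inc}[\tilde x_k,\tilde x_l]$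 is the projection of $p_{ij}$ through the line $\operatorname{inc}[\tilde x_i,\tilde x_j]$ onto $\operatorname{inc}[\tilde x_k,\tilde x_l]$, i.e. $\tilde p_{kl}=\operatorname{inc}[p_{ij},\tilde x_i,\tilde x_j]\cap\operatorname{inc}[\tilde x_k,\tilde x_l]$. In an A-cube this point coincides with the projection of $p_{ij}$ through the line $\operatorname{inc}[x_k,x_l]$ onto $\operatorname{inc}[\tilde x_k,\tilde x_l]$: the points $p_{ij},\tilde x_i,\tilde x_j,\tilde p_{kl}$ are coplanar if and only if the points $p_{ij},x_k,x_l,\tilde p_{kl}$ are coplanar.
   Formalization: The A-cube is assumed not to have x1, x3, x̃2, x̃4 on one line and x2, x4, x̃1, x̃3 on another (the claim can fail there); the Weingarten equation is asserted except when both q = q̃ and the two cross planes coincide, where it is false. *)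

theory Defs
  imports "HOL-Analysis.Analysis"
begin

text \<open>
  A point of real projective 3-space is a line through the origin of the space
  \<open>(real^3) \<times> real\<close> of homogeneous coordinates. A subspace of dimension \<open>d\<close> of projective space is
  represented by the linear subspace of dimension \<open>d + 1\<close> over it, so that intersections are
  plain set intersections, and points at infinity are the lines inside \<open>UNIV \<times> {0}\<close>.
\<close>

typedef rp3 = "{L :: ((real^3) \<times> real) set. subspace L \<and> dim L = 1}"
  morphisms hline Abs_rp3
proof -
  have "dim (span {(0 :: real^3, 1 :: real)}) = 1"
    by (simp add: dim_eq_card_independent zero_prod_def)
  then show ?thesis
    by (metis (mono_tags, lifting) mem_Collect_eq subspace_span)
qed

definition aff :: "real^3 \<Rightarrow> rp3" where
  "aff x = Abs_rp3 (span {(x, 1)})"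

definition inc :: "rp3 set \<Rightarrow> ((real^3) \<times> real) set" where
  "inc S = span (\<Union> (hline ` S))"

definition skew_quad :: "real^3 \<Rightarrow> real^3 \<Rightarrow> real^3 \<Rightarrow> real^3 \<Rightarrow> bool" where
  "skew_quad a b c d \<longleftrightarrow> \<not> coplanar {a, b, c, d}"

definition planar_star :: "real^3 \<Rightarrow> real^3 \<Rightarrow> real^3 \<Rightarrow> real^3 \<Rightarrow> bool" where
  "planar_star v a b c \<longleftrightarrow> (\<exists>!E. affine E \<and> aff_dim E = 2 \<and> {v, a, b, c} \<subseteq> E)"

text \<open>
  The index type \<open>4\<close> is the ring of integers modulo 4 (with \<open>4 = 0\<close>), so \<open>i + 1\<close>, \<open>i - 1\<close> are the
  cyclic neighbours of \<open>i\<close>. The second argument \<open>x'\<close> stands for the vertices with a tilde.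
\<close>

definition A_cube :: "(4 \<Rightarrow> real^3) \<Rightarrow> (4 \<Rightarrow> real^3) \<Rightarrow> bool" where
  "A_cube x x' \<longleftrightarrow>
     skew_quad (x 1) (x 2) (x 3) (x 4) \<and>
     skew_quad (x' 1) (x' 2) (x' 3) (x' 4) \<and>
     (\<forall>i. skew_quad (x i) (x (i + 1)) (x' (i + 1)) (x' i)) \<and>
     (\<forall>i. planar_star (x i) (x (i - 1)) (x (i + 1)) (x' i)) \<and>
     (\<forall>i. planar_star (x' i) (x' (i - 1)) (x' (i + 1)) (x i))"

text \<open>
  The two colour classes of the bipartite edge graph of the cube are \<open>x\<^sub>1, x\<^sub>3, x'\<^sub>2, x'\<^sub>4\<close> and
  \<open>x\<^sub>2, x\<^sub>4, x'\<^sub>1, x'\<^sub>3\<close>. If the classes lie on two skew lines, then all vertex stars are planar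
  whatever the positions of the vertices on these lines are, so the planarity of the stars does not
  relate the edges of the cube to one another. In such a cube the projections of a point through
  the two lines \<open>inc[x'\<^sub>i, x'\<^sub>j]\<close> and \<open>inc[x\<^sub>k, x\<^sub>l]\<close> in general differ.
\<close>

definition two_line_cube :: "(4 \<Rightarrow> real^3) \<Rightarrow> (4 \<Rightarrow> real^3) \<Rightarrow> bool" where
  "two_line_cube x x' \<longleftrightarrow>
     collinear {x 1, x 3, x' 2, x' 4} \<and> collinear {x 2, x 4, x' 1, x' 3}"

text \<open>
  A cross \<open>p\<close> is indexed by the edges: \<open>p i\<close> is the point on the edge from \<open>x i\<close> to \<open>x (i + 1)\<close>, that is,
  \<open>p 1, p 2, p 3, p 4\<close> are \<open>p\<^sub>1\<^sub>2, p\<^sub>2\<^sub>3, p\<^sub>3\<^sub>4, p\<^sub>4\<^sub>1\<close>.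
\<close>

definition is_cross :: "(4 \<Rightarrow> real^3) \<Rightarrow> (4 \<Rightarrow> rp3) \<Rightarrow> bool" where
  "is_cross x p \<longleftrightarrow>
     (\<forall>i. hline (p i) \<subseteq> inc {aff (x i), aff (x (i + 1))} \<and>
          p i \<noteq> aff (x i) \<and> p i \<noteq> aff (x (i + 1))) \<and>
     dim (inc {p 1, p 2, p 3, p 4}) \<le> 3"

definition is_centre :: "(4 \<Rightarrow> rp3) \<Rightarrow> rp3 \<Rightarrow> bool" where
  "is_centre p q \<longleftrightarrow> hline q = inc {p 1, p 3} \<inter> inc {p 2, p 4}"

text \<open>
  For the cyclic choice \<open>(i, j, k, l) = (i, i + 1, i + 2, i + 3)\<close> the point \<open>p\<^sub>i\<^sub>j\<close> is \<open>p i\<close> and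
  \<open>p'\<^sub>k\<^sub>l\<close> is \<open>p' (i + 2)\<close>.
\<close>

definition C1_propagation :: "(4 \<Rightarrow> real^3) \<Rightarrow> (4 \<Rightarrow> rp3) \<Rightarrow> (4 \<Rightarrow> rp3) \<Rightarrow> bool" where
  "C1_propagation x' p p' \<longleftrightarrow>
     (\<forall>i. hline (p' (i + 2)) =
        inc {p i, aff (x' i), aff (x' (i + 1))} \<inter> inc {aff (x' (i + 2)), aff (x' (i + 3))})"

end

theory Submission
  imports Defs
begin

text \<open>
  In homogeneous coordinates write \<open>X i\<close>, \<open>Y i\<close> for the vertices of the two faces. The stars at the
  \<open>x i\<close> give \<open>Y i = a i X i + b i X (i - 1) + c i X (i + 1)\<close> with \<open>b i\<close>, \<open>c i\<close> nonzero, and the stars at the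
  \<open>x' i\<close> give a linear system for the \<open>a i\<close>, so that either all \<open>a i\<close> vanish (the two-line cube) or
  the products of the \<open>b i\<close> and of the \<open>c i\<close> agree. The points of a cross are coplanar iff the product
  of their affine ratios is 1; hence the \<open>X i\<close> can be rescaled such that the cross vertices are
  \<open>X i + X (i + 1)\<close>, and then the \<open>Y i\<close> such that \<open>c (i + 1) = b i\<close>. Now \<open>a (i + 2) = - a i\<close>, the
  propagated cross is \<open>Y i + Y (i + 1)\<close>, and the centres are the sums of the \<open>X i\<close> and of the \<open>Y i\<close>.
  The cross planes consist of the combinations with vanishing alternating coefficient sum, and
  explicit identities show that each contains the other centre. The centres coincide exactly
  when the planes do.
\<close>

section \<open>Independent quadruples\<close>

text \<open>Stated with coefficients instead of \<open>independent {A, B, C, D}\<close>: the set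
  would collapse if two vectors coincided, whereas this form excludes coincidences.\<close>

definition lin4 :: "'a::real_vector \<Rightarrow> 'a \<Rightarrow> 'a \<Rightarrow> 'a \<Rightarrow> bool" where
  "lin4 A B C D \<longleftrightarrow> (\<forall>a b c d. a *\<^sub>R A + b *\<^sub>R B + c *\<^sub>R C + d *\<^sub>R D = 0 \<longrightarrow>
     a = 0 \<and> b = 0 \<and> c = 0 \<and> d = 0)"

lemma lin4D:
  assumes "lin4 A B C D" "a *\<^sub>R A + b *\<^sub>R B + c *\<^sub>R C + d *\<^sub>R D = 0"
  shows "a = 0" "b = 0" "c = 0" "d = 0"
  using assms unfolding lin4_def by blast+

lemma lin4_rotate: "lin4 A B C D \<Longrightarrow> lin4 B C D A"
  unfolding lin4_def
proof (intro allI impI, goal_cases)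
  case (1 b c d a)
  then have "a *\<^sub>R A + b *\<^sub>R B + c *\<^sub>R C + d *\<^sub>R D = 0" by (simp only: add_ac)
  with 1(1) show ?case by blast
qed

lemma lin4_scale:
  assumes "lin4 A B C D" "a \<noteq> 0" "b \<noteq> 0" "c \<noteq> 0" "d \<noteq> 0"
  shows "lin4 (a *\<^sub>R A) (b *\<^sub>R B) (c *\<^sub>R C) (d *\<^sub>R D)"
  unfolding lin4_def scaleR_scaleR using lin4D[OF assms(1)] assms(2-) by (metis mult_eq_0_iff)

lemma lin4_nonzero:
  assumes "lin4 A B C D"
  shows "A \<noteq> 0" "A + B \<noteq> 0"
  using lin4D[OF assms, of 1 0 0 0] lin4D[OF assms, of 1 1 0 0] by auto

lemma lin4_independent:
  assumes "lin4 A B C D"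
  shows "independent {A, B, C, D}" "card {A, B, C, D} = 4"
proof -
  have d: "A \<noteq> B" "A \<noteq> C" "A \<noteq> D" "B \<noteq> C" "B \<noteq> D" "C \<noteq> D"
    using lin4D[OF assms, of 1 "-1" 0 0] lin4D[OF assms, of 1 0 "-1" 0] lin4D[OF assms, of 1 0 0 "-1"]
      lin4D[OF assms, of 0 1 "-1" 0] lin4D[OF assms, of 0 1 0 "-1"] lin4D[OF assms, of 0 0 1 "-1"]
    by auto
  then show "card {A, B, C, D} = 4" by simp
  show "independent {A, B, C, D}"
  proof
    assume "dependent {A, B, C, D}"
    then obtain u where u: "\<exists>v\<in>{A, B, C, D}. u v \<noteq> 0" "(\<Sum>v\<in>{A, B, C, D}. u v *\<^sub>R v) = 0"
      using dependent_finite[of "{A, B, C, D}"] by auto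
    from u(2) d have "u A *\<^sub>R A + u B *\<^sub>R B + u C *\<^sub>R C + u D *\<^sub>R D = 0"
      by (simp add: add.assoc)
    from lin4D[OF assms this] u(1) show False by blast
  qed
qed

lemma mem_span2: "v \<in> span {A, B} \<longleftrightarrow> (\<exists>a b. v = a *\<^sub>R A + b *\<^sub>R B)"
  by (simp add: span_breakdown_eq diff_eq_eq add_ac)

lemma mem_span3: "v \<in> span {A, B, C} \<longleftrightarrow> (\<exists>a b c. v = a *\<^sub>R A + b *\<^sub>R B + c *\<^sub>R C)"
  by (simp add: span_breakdown_eq diff_eq_eq add_ac)

lemma mem_span4: "v \<in> span {A, B, C, D} \<longleftrightarrow> (\<exists>a b c d. v = a *\<^sub>R A + b *\<^sub>R B + c *\<^sub>R C + d *\<^sub>R D)"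
  by (simp add: span_breakdown_eq diff_eq_eq add_ac)

lemma lin4_span:
  fixes A :: "'a::euclidean_space"
  assumes "lin4 A B C D" "DIM('a) = 4"
  obtains a b c d where "v = a *\<^sub>R A + b *\<^sub>R B + c *\<^sub>R C + d *\<^sub>R D"
proof -
  have "UNIV \<subseteq> span {A, B, C, D}"
    using lin4_independent[OF assms(1)] assms(2) by (intro card_ge_dim_independent) auto
  then have "v \<in> span {A, B, C, D}" by auto
  then show ?thesis using that unfolding mem_span4 by blast
qed

lemma not_lin4_if_dim_le:
  assumes "dim (span {A, B, C, D}) \<le> 3"
  shows "\<not> lin4 A B C D"
  using assms lin4_independent[of A B C D] dim_eq_card_independent[of "{A, B, C, D}"] by auto

lemma lin4_dim3:
  assumes "lin4 A B C D"
  shows "dim (span {B, C, D}) = 3"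
proof -
  have "independent {B, C, D}"
    using lin4_independent(1)[OF assms] by (rule independent_mono) blast
  moreover have "A \<notin> {B, C, D}"
    using lin4_independent(2)[OF assms] by (auto simp: card_insert_if split: if_splits)
  ultimately show ?thesis
    using lin4_independent(2)[OF assms] by (simp add: dim_eq_card_independent)
qed

section \<open>Homogeneous coordinates\<close>

text \<open>The last homogeneous coordinate of a linear relation says that its coefficients sum to
  0; a nonzero coefficient would then make one vertex an affine combination of the other
  three.\<close>

lemma lin4_hom:
  fixes a b c d :: "real^3"
  assumes "skew_quad a b c d"
  shows "lin4 (a, 1::real) (b, 1) (c, 1) (d, 1)"
proof -
  have aux: "r = 0" if eq: "r *\<^sub>R a + s *\<^sub>R b + t *\<^sub>R c + u *\<^sub>R d = 0" "r + s + t + u = 0"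
    and n: "\<not> coplanar {a, b, c, d}" for r s t u :: real and a b c d :: "real^3"
  proof (rule ccontr)
    assume r: "r \<noteq> 0"
    have "a = (1 / r) *\<^sub>R (r *\<^sub>R a)" using r by simp
    also have "r *\<^sub>R a = - (s *\<^sub>R b + t *\<^sub>R c + u *\<^sub>R d)"
      unfolding eq_neg_iff_add_eq_0 using eq(1) by (simp only: add.assoc)
    finally have "a = (- s / r) *\<^sub>R b + (- t / r) *\<^sub>R c + (- u / r) *\<^sub>R d"
      by (simp add: algebra_simps)
    moreover have "(- s / r) + (- t / r) + (- u / r) = 1"
    proof -
      have "- s + - t + - u = r" using eq(2) by simp
      then have "(- s + - t + - u) / r = 1" using r by simp
      then show ?thesis by (simp only: add_divide_distrib)
    qed
    ultimately have "a \<in> affine hull {b, c, d}"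
      unfolding affine_hull_3 by blast
    then have "{a, b, c, d} \<subseteq> affine hull {b, c, d}"
      by (simp add: hull_inc)
    with n show False unfolding coplanar_def by blast
  qed
  \<comment> \<open>\<open>aux\<close> treats the first coefficient only; rotating the points brings
    each coefficient to the front.\<close>
  have n: "\<not> coplanar {a, b, c, d}" "\<not> coplanar {b, c, d, a}" "\<not> coplanar {c, d, a, b}"
    "\<not> coplanar {d, a, b, c}"
    using assms unfolding skew_quad_def by (metis insert_commute)+
  show ?thesis
    unfolding lin4_def
  proof (intro allI impI, goal_cases)
    case (1 r s t u)
    then have e: "r *\<^sub>R a + s *\<^sub>R b + t *\<^sub>R c + u *\<^sub>R d = 0" "r + s + t + u = 0"
      by (simp_all add: zero_prod_def)
    moreover have "s *\<^sub>R b + t *\<^sub>R c + u *\<^sub>R d + r *\<^sub>R a = 0" "s + t + u + r = 0"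
      "t *\<^sub>R c + u *\<^sub>R d + r *\<^sub>R a + s *\<^sub>R b = 0" "t + u + r + s = 0"
      "u *\<^sub>R d + r *\<^sub>R a + s *\<^sub>R b + t *\<^sub>R c = 0" "u + r + s + t = 0"
      using e by (simp_all only: add_ac)
    ultimately show ?case
      using aux[OF _ _ n(1)] aux[OF _ _ n(2)] aux[OF _ _ n(3)] aux[OF _ _ n(4)] by metis
  qed
qed

text \<open>\<open>N\<close> holds the plane coordinates: a normal vector together with the negated
  offset.\<close>

lemma planar_star_hom:
  assumes "planar_star v a b c"
  obtains N :: "(real^3) \<times> real"
  where "N \<noteq> 0" "N \<bullet> (v, 1) = 0" "N \<bullet> (a, 1) = 0" "N \<bullet> (b, 1) = 0" "N \<bullet> (c, 1) = 0"
proof -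
  obtain E where E: "aff_dim E = 2" "{v, a, b, c} \<subseteq> E"
    using assms unfolding planar_star_def by blast
  obtain n r where "n \<noteq> 0" "E \<subseteq> {x. n \<bullet> x = r}"
    using aff_lowdim_subset_hyperplane[of E] E by auto
  then show ?thesis
    using E(2) that[of "(n, - r)"] by (auto simp: zero_prod_def)
qed

lemma mem_affine_hull_hom:
  assumes "(w, 1::real) = r *\<^sub>R (u, 1) + s *\<^sub>R (v, 1)"
  shows "w \<in> affine hull {u, v}"
  using assms unfolding affine_hull_2 by auto

section \<open>Projective points and their joins in terms of representing vectors\<close>

definition pt :: "(real^3) \<times> real \<Rightarrow> rp3" where
  "pt v = Abs_rp3 (span {v})"

lemma hline_pt [simp]: "v \<noteq> 0 \<Longrightarrow> hline (pt v) = span {v}"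
  unfolding pt_def by (rule Abs_rp3_inverse) (simp add: dim_eq_card_independent)

lemma aff_eq_pt: "aff x = pt (x, 1)"
  unfolding aff_def pt_def ..

lemma pt_scale: "k \<noteq> 0 \<Longrightarrow> pt (k *\<^sub>R v) = pt v"
  unfolding pt_def using span_image_scale[of "{v}" "\<lambda>_. k"] by simp

lemma pt_eq_iff:
  assumes "v \<noteq> 0" "w \<noteq> 0"
  shows "pt v = pt w \<longleftrightarrow> (\<exists>k. w = k *\<^sub>R v)"
proof
  assume "pt v = pt w"
  then have "span {v} = span {w}" using hline_pt assms by metis
  then have "w \<in> span {v}" by (simp add: span_base)
  then show "\<exists>k. w = k *\<^sub>R v" by (auto simp: span_singleton)
next
  assume "\<exists>k. w = k *\<^sub>R v"
  then show "pt v = pt w" using assms pt_scale by (metis scaleR_zero_left)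
qed

lemma rp3_cases:
  obtains v where "v \<noteq> 0" "P = pt v"
proof -
  have "subspace (hline P)" "dim (hline P) = 1" using hline[of P] by auto
  then obtain v where "v \<in> hline P" "v \<noteq> 0"
    by (metis dim_eq_0 subsetI singletonI subset_singletonD zero_neq_one singleton_iff subspace_0)
  moreover have "span {v} = hline P"
    using calculation \<open>subspace (hline P)\<close> \<open>dim (hline P) = 1\<close>
    by (intro subspace_dim_equal) (auto simp: span_minimal dim_eq_card_independent)
  ultimately show ?thesis using that[of v] unfolding pt_def by (metis hline_inverse)
qed

text \<open>The vector 0 has to be excluded: \<open>span {0}\<close> has dimension 0, so
  \<open>pt 0\<close> is an unspecified point.\<close>

lemma inc_pt:
  assumes "0 \<notin> S"
  shows "inc (pt ` S) = span S"
proof -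
  have "\<Union> (hline ` pt ` S) = (\<Union>v\<in>S. span {v})"
    using assms by (auto simp: image_image) (metis hline_pt)+
  moreover have "span (\<Union>v\<in>S. span {v}) = span S"
  proof (rule span_eq[THEN iffD2], intro conjI subsetI)
    show "x \<in> span S" if "x \<in> (\<Union>v\<in>S. span {v})" for x
      using that span_mono[of "{_}" S] by blast
    show "x \<in> span (\<Union>v\<in>S. span {v})" if "x \<in> S" for x
      using that by (intro span_base) (auto intro: span_base)
  qed
  ultimately show ?thesis unfolding inc_def by simp
qed

lemma inc_pt2: "A \<noteq> 0 \<Longrightarrow> B \<noteq> 0 \<Longrightarrow> inc {pt A, pt B} = span {A, B}"
  using inc_pt[of "{A, B}"] by simp

lemma inc_pt3: "A \<noteq> 0 \<Longrightarrow> B \<noteq> 0 \<Longrightarrow> C \<noteq> 0 \<Longrightarrow> inc {pt A, pt B, pt C} = span {A, B, C}"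
  using inc_pt[of "{A, B, C}"] by simp

lemma inc_pt4: "A \<noteq> 0 \<Longrightarrow> B \<noteq> 0 \<Longrightarrow> C \<noteq> 0 \<Longrightarrow> D \<noteq> 0 \<Longrightarrow>
    inc {pt A, pt B, pt C, pt D} = span {A, B, C, D}"
  using inc_pt[of "{A, B, C, D}"] by simp

lemmas inc_pts = inc_pt2 inc_pt3 inc_pt4

text \<open>Turns explicit vector identities into real polynomial identities.\<close>

lemma eq_if_inner_eq: "(\<And>w. u \<bullet> w = v \<bullet> w) \<Longrightarrow> u = (v::'a::real_inner)"
  by (metis vector_eq_ldot inner_commute)

section \<open>A-cubes with normalised coordinates\<close>

text \<open>Scaled so that the sums of cyclically consecutive \<open>X\<close> are the cross
  vertices. Each of the \<open>b\<close> occurs in two consecutive \<open>Y\<close>; for instance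
  \<open>Y1 + Y2\<close> contains \<open>X3\<close> and \<open>X4\<close> with the same coefficient
  \<open>b1\<close>, hence a multiple of the opposite cross vertex.\<close>

locale normal_cube =
  fixes X1 X2 X3 X4 Y1 Y2 Y3 Y4 :: "'a::euclidean_space" and a1 a2 b1 b2 b3 b4 :: real
  assumes X: "lin4 X1 X2 X3 X4"
    and Y: "lin4 Y1 Y2 Y3 Y4"
    and Y1: "Y1 = a1 *\<^sub>R X1 + b1 *\<^sub>R X4 + b4 *\<^sub>R X2"
    and Y2: "Y2 = a2 *\<^sub>R X2 + b2 *\<^sub>R X1 + b1 *\<^sub>R X3"
    and Y3: "Y3 = - a1 *\<^sub>R X3 + b3 *\<^sub>R X2 + b2 *\<^sub>R X4"
    and Y4: "Y4 = - a2 *\<^sub>R X4 + b4 *\<^sub>R X3 + b3 *\<^sub>R X1"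
    and b: "b1 \<noteq> 0" "b2 \<noteq> 0" "b3 \<noteq> 0" "b4 \<noteq> 0"
begin

text \<open>Cyclic symmetry, by which one edge represents all four. The sign at \<open>a1\<close>
  comes from opposite vertices having opposite diagonal coefficients.\<close>

lemma rotate: "normal_cube X2 X3 X4 X1 Y2 Y3 Y4 Y1 a2 (- a1) b2 b3 b4 b1"
  using X Y Y1 Y2 Y3 Y4 b lin4_rotate by unfold_locales auto

text \<open>The coefficient of the cross vertex in the next two identities; \<open>rotate\<close>
  only changes its sign.\<close>

definition "\<delta> = b1 * b3 - b2 * b4 + a1 * a2"

text \<open>Eliminate \<open>X4\<close> and \<open>X3\<close> from \<open>Y3 + Y4\<close> by means
  of \<open>Y1\<close> and \<open>Y2\<close>, where their coefficient is \<open>b1\<close>. The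
  coefficients left at \<open>X1\<close> and \<open>X2\<close> are both \<open>\<delta>\<close>, so
  \<open>X1 + X2\<close>, \<open>Y1\<close>, \<open>Y2\<close>, \<open>Y3 + Y4\<close> lie in a
  plane, as the propagation requires.\<close>

lemma edge34_expansion: "b1 *\<^sub>R (Y3 + Y4) = (b2 - a2) *\<^sub>R Y1 + (b4 - a1) *\<^sub>R Y2 + \<delta> *\<^sub>R (X1 + X2)"
  unfolding Y1 Y2 Y3 Y4 \<delta>_def by (rule eq_if_inner_eq) (simp add: inner_simps algebra_simps)

text \<open>The previous identity shifted by two indices, which preserves
  \<open>\<delta>\<close>.\<close>

lemma edge12_expansion: "b3 *\<^sub>R (Y1 + Y2) = (b4 + a2) *\<^sub>R Y3 + (b2 + a1) *\<^sub>R Y4 + \<delta> *\<^sub>R (X3 + X4)"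
  unfolding Y1 Y2 Y3 Y4 \<delta>_def by (rule eq_if_inner_eq) (simp add: inner_simps algebra_simps)

lemma \<delta>_nonzero: "\<delta> \<noteq> 0"
proof
  assume "\<delta> = 0"
  then have "(a2 - b2) *\<^sub>R Y1 + (a1 - b4) *\<^sub>R Y2 + b1 *\<^sub>R Y3 + b1 *\<^sub>R Y4 = 0"
    using edge34_expansion by (simp add: algebra_simps)
  from lin4D(3)[OF Y this] b show False by simp
qed

text \<open>The propagation of one cross vertex. Multiplying by \<open>\<delta>\<close> allows the
  edge expansion to replace \<open>X1 + X2\<close>; the coefficients of \<open>Y3\<close> and
  \<open>Y4\<close> then have to agree.\<close>

lemma projection: "span {X1 + X2, Y1, Y2} \<inter> span {Y3, Y4} = span {Y3 + Y4}"
proof (intro equalityI subsetI)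
  fix v assume "v \<in> span {X1 + X2, Y1, Y2} \<inter> span {Y3, Y4}"
  then obtain e f g h k where v: "v = e *\<^sub>R (X1 + X2) + f *\<^sub>R Y1 + g *\<^sub>R Y2" "v = h *\<^sub>R Y3 + k *\<^sub>R Y4"
    unfolding Int_iff mem_span2 mem_span3 by blast
  have "\<delta> *\<^sub>R v = e *\<^sub>R (\<delta> *\<^sub>R (X1 + X2)) + (\<delta> * f) *\<^sub>R Y1 + (\<delta> * g) *\<^sub>R Y2"
    unfolding v(1) by (simp add: algebra_simps)
  also have "\<delta> *\<^sub>R (X1 + X2) = b1 *\<^sub>R (Y3 + Y4) - (b2 - a2) *\<^sub>R Y1 - (b4 - a1) *\<^sub>R Y2"
    using edge34_expansion by (simp add: algebra_simps)
  finally have "(\<delta> * f - e * (b2 - a2)) *\<^sub>R Y1 + (\<delta> * g - e * (b4 - a1)) *\<^sub>R Y2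
      + (e * b1 - \<delta> * h) *\<^sub>R Y3 + (e * b1 - \<delta> * k) *\<^sub>R Y4 = 0"
    unfolding v(2) by (simp add: algebra_simps)
  from lin4D(3,4)[OF Y this] \<delta>_nonzero have "h = k" by (metis eq_iff_diff_eq_0 mult_left_cancel)
  then show "v \<in> span {Y3 + Y4}"
    unfolding v(2) span_singleton by (metis rangeI scaleR_add_right)
next
  fix v assume "v \<in> span {Y3 + Y4}"
  then obtain k where v: "v = k *\<^sub>R (Y3 + Y4)" by (auto simp: span_singleton)
  define h where "h = k / b1"
  have "v = h *\<^sub>R (b1 *\<^sub>R (Y3 + Y4))" using b v by (simp add: h_def)
  also have "\<dots> = (h * \<delta>) *\<^sub>R (X1 + X2) + (h * (b2 - a2)) *\<^sub>R Y1 + (h * (b4 - a1)) *\<^sub>R Y2"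
    unfolding edge34_expansion by (simp add: algebra_simps)
  finally have "v \<in> span {X1 + X2, Y1, Y2}" unfolding mem_span3 by blast
  moreover have "v \<in> span {Y3, Y4}" unfolding mem_span2 v by (auto simp: algebra_simps)
  ultimately show "v \<in> span {X1 + X2, Y1, Y2} \<inter> span {Y3, Y4}" by blast
qed

end

section \<open>The plane and the centre of a cross\<close>

definition cross_plane :: "'a::real_vector \<Rightarrow> 'a \<Rightarrow> 'a \<Rightarrow> 'a \<Rightarrow> 'a set" where
  "cross_plane A B C D = span {A + B, B + C, C + D, D + A}"

lemma subspace_cross_plane [simp]: "subspace (cross_plane A B C D)"
  by (simp add: cross_plane_def)

lemma mem_cross_planeI:
  assumes "v = r *\<^sub>R A + s *\<^sub>R B + t *\<^sub>R C + u *\<^sub>R D" "r + t = s + u"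
  shows "v \<in> cross_plane A B C D"
proof -
  have u: "u = r + t - s" using assms(2) by simp
  \<comment> \<open>\<open>D + A\<close> is the alternating sum of the other three generators, so
    its coefficient can be chosen as 0.\<close>
  have "v = r *\<^sub>R (A + B) + (s - r) *\<^sub>R (B + C) + (r + t - s) *\<^sub>R (C + D) + 0 *\<^sub>R (D + A)"
    using assms(1) unfolding u by (simp add: algebra_simps)
  then show ?thesis unfolding cross_plane_def mem_span4 by blast
qed

lemma mem_cross_planeD:
  assumes "lin4 A B C D" "r *\<^sub>R A + s *\<^sub>R B + t *\<^sub>R C + u *\<^sub>R D \<in> cross_plane A B C D"
  shows "r + t = s + u"
proof -
  obtain e f g h where
    "r *\<^sub>R A + s *\<^sub>R B + t *\<^sub>R C + u *\<^sub>R D = e *\<^sub>R (A + B) + f *\<^sub>R (B + C) + g *\<^sub>R (C + D) + h *\<^sub>R (D + A)"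
    using assms(2) unfolding cross_plane_def mem_span4 by blast
  then have "(r - e - h) *\<^sub>R A + (s - e - f) *\<^sub>R B + (t - f - g) *\<^sub>R C + (u - g - h) *\<^sub>R D = 0"
    by (simp add: algebra_simps)
  from lin4D[OF assms(1) this] show ?thesis by simp
qed

text \<open>Three generators stay independent even after adding \<open>A\<close>, and the fourth is
  their alternating sum.\<close>

lemma cross_plane_dim:
  assumes "lin4 A B C D"
  shows "dim (cross_plane A B C D) = 3"
proof -
  have "lin4 A (A + B) (B + C) (C + D)"
    unfolding lin4_def
  proof (intro allI impI)
    fix r s t u
    assume "r *\<^sub>R A + s *\<^sub>R (A + B) + t *\<^sub>R (B + C) + u *\<^sub>R (C + D) = 0"
    then have "(r + s) *\<^sub>R A + (s + t) *\<^sub>R B + (t + u) *\<^sub>R C + u *\<^sub>R D = 0"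
      by (simp add: algebra_simps)
    from lin4D[OF assms this] show "r = 0 \<and> s = 0 \<and> t = 0 \<and> u = 0" by simp
  qed
  then have "dim (span {A + B, B + C, C + D}) = 3" by (rule lin4_dim3)
  moreover have "cross_plane A B C D = span {A + B, B + C, C + D}"
  proof -
    have "D + A = 1 *\<^sub>R (A + B) + (-1) *\<^sub>R (B + C) + 1 *\<^sub>R (C + D)" by simp
    then have "D + A \<in> span {A + B, B + C, C + D}" unfolding mem_span3 by blast
    moreover have "cross_plane A B C D = span (insert (D + A) {A + B, B + C, C + D})"
      unfolding cross_plane_def by (simp add: insert_commute)
    ultimately show ?thesis by (simp add: span_redundant)
  qed
  ultimately show ?thesis by simp
qed

text \<open>Comparing coefficients on the two crossing lines forces all four to be equal.\<close>

lemma cross_centre: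
  assumes "lin4 A B C D"
  shows "span {A + B, C + D} \<inter> span {B + C, D + A} = span {A + B + C + D}"
proof (intro equalityI subsetI)
  fix v assume "v \<in> span {A + B, C + D} \<inter> span {B + C, D + A}"
  then obtain e f g h where v: "v = e *\<^sub>R (A + B) + f *\<^sub>R (C + D)" "v = g *\<^sub>R (B + C) + h *\<^sub>R (D + A)"
    unfolding Int_iff mem_span2 by blast
  then have "(e - h) *\<^sub>R A + (e - g) *\<^sub>R B + (f - g) *\<^sub>R C + (f - h) *\<^sub>R D = 0"
    by (simp add: algebra_simps)
  from lin4D[OF assms this] have "v = e *\<^sub>R (A + B + C + D)"
    unfolding v(1) by (simp add: algebra_simps)
  then show "v \<in> span {A + B + C + D}" unfolding span_singleton by blast
next
  fix v assume "v \<in> span {A + B + C + D}"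
  then obtain k where "v = k *\<^sub>R (A + B + C + D)" by (auto simp: span_singleton)
  then have "v = k *\<^sub>R (A + B) + k *\<^sub>R (C + D)" "v = k *\<^sub>R (B + C) + k *\<^sub>R (D + A)"
    by (simp_all add: algebra_simps)
  then show "v \<in> span {A + B, C + D} \<inter> span {B + C, D + A}"
    unfolding Int_iff mem_span2 by blast
qed

section \<open>The Weingarten property in normalised coordinates\<close>

context normal_cube
begin

abbreviation "plane \<equiv> cross_plane X1 X2 X3 X4"
abbreviation "plane' \<equiv> cross_plane Y1 Y2 Y3 Y4"
abbreviation "Q \<equiv> X1 + X2 + X3 + X4"
abbreviation "Q' \<equiv> Y1 + Y2 + Y3 + Y4"

lemma centre'_mem: "Q' \<in> plane"
  \<comment> \<open>The witnesses are the coefficients of \<open>Q'\<close>; the \<open>a\<close>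
    cancel, and both \<open>r + t\<close> and \<open>s + u\<close> equal
    \<open>b1 + b2 + b3 + b4\<close>.\<close>
  by (rule mem_cross_planeI[where r = "a1 + b2 + b3" and s = "a2 + b3 + b4" and t = "b4 + b1 - a1"
        and u = "b1 + b2 - a2"]) (auto simp: Y1 Y2 Y3 Y4 algebra_simps)

lemma centre_mem: "Q \<in> plane'"
proof -
  have "\<delta> *\<^sub>R Q = \<delta> *\<^sub>R (X1 + X2) + \<delta> *\<^sub>R (X3 + X4)" by (simp add: algebra_simps)
  \<comment> \<open>Adding the two edge expansions gives \<open>Y\<close> coefficients whose
    alternating sum vanishes.\<close>
  also have "\<dots> = (b3 - b2 + a2) *\<^sub>R Y1 + (b3 - b4 + a1) *\<^sub>R Y2 + (b1 - b4 - a2) *\<^sub>R Y3 + (b1 - b2 - a1) *\<^sub>R Y4"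
    using edge34_expansion edge12_expansion by (simp add: algebra_simps)
  finally have "\<delta> *\<^sub>R Q \<in> plane'"
    by (rule mem_cross_planeI) simp
  then have "(1 / \<delta>) *\<^sub>R \<delta> *\<^sub>R Q \<in> plane'" unfolding cross_plane_def by (rule span_scale)
  then show ?thesis using \<delta>_nonzero by simp
qed

text \<open>Proportional centres make the four \<open>X\<close> coefficients of \<open>Q'\<close>
  equal to \<open>k\<close>; the alternating sums of all edge sums of the \<open>Y\<close> then
  vanish.\<close>

lemma planes_eq_if: assumes "Q' = k *\<^sub>R Q" shows "plane' = plane"
proof -
  have "(a1 + b2 + b3 - k) *\<^sub>R X1 + (a2 + b3 + b4 - k) *\<^sub>R X2 + (b4 + b1 - a1 - k) *\<^sub>R X3
     + (b1 + b2 - a2 - k) *\<^sub>R X4 = 0"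
    using assms by (simp add: Y1 Y2 Y3 Y4 algebra_simps)
  note c = lin4D[OF X this]
  have "Y1 + Y2 \<in> plane"
    by (rule mem_cross_planeI[where r = "a1 + b2" and s = "a2 + b4" and t = "b1" and u = "b1"])
      (use c in \<open>auto simp: Y1 Y2 algebra_simps\<close>)
  moreover have "Y2 + Y3 \<in> plane"
    by (rule mem_cross_planeI[where r = "b2" and s = "a2 + b3" and t = "b1 - a1" and u = "b2"])
      (use c in \<open>auto simp: Y2 Y3 algebra_simps\<close>)
  moreover have "Y3 + Y4 \<in> plane"
    by (rule mem_cross_planeI[where r = "b3" and s = "b3" and t = "b4 - a1" and u = "b2 - a2"])
      (use c in \<open>auto simp: Y3 Y4 algebra_simps\<close>)
  moreover have "Y4 + Y1 \<in> plane"
    by (rule mem_cross_planeI[where r = "b3 + a1" and s = "b4" and t = "b4" and u = "b1 - a2"])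
      (use c in \<open>auto simp: Y4 Y1 algebra_simps\<close>)
  ultimately have "plane' \<subseteq> plane"
    unfolding cross_plane_def[of Y1] by (intro span_minimal) (auto simp: cross_plane_def)
  then show ?thesis
    using cross_plane_dim[OF X] cross_plane_dim[OF Y]
    by (intro subspace_dim_equal) (auto simp: cross_plane_def)
qed

text \<open>Three edge sums of the \<open>Y\<close> lying in \<open>plane\<close> give three
  equations, exactly those that equate the four \<open>X\<close> coefficients of
  \<open>Q'\<close>.\<close>

lemma centre_eq_if: assumes "plane' = plane" obtains k where "Q' = k *\<^sub>R Q"
proof -
  have "Y1 + Y2 \<in> plane" "Y2 + Y3 \<in> plane" "Y3 + Y4 \<in> plane"
    unfolding assms[symmetric] by (auto simp: cross_plane_def intro: span_base)
  moreover have "Y1 + Y2 = (a1 + b2) *\<^sub>R X1 + (a2 + b4) *\<^sub>R X2 + b1 *\<^sub>R X3 + b1 *\<^sub>R X4"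
    "Y2 + Y3 = b2 *\<^sub>R X1 + (a2 + b3) *\<^sub>R X2 + (b1 - a1) *\<^sub>R X3 + b2 *\<^sub>R X4"
    "Y3 + Y4 = b3 *\<^sub>R X1 + b3 *\<^sub>R X2 + (b4 - a1) *\<^sub>R X3 + (b2 - a2) *\<^sub>R X4"
    by (simp_all add: Y1 Y2 Y3 Y4 algebra_simps)
  ultimately have e: "a1 + b2 + b1 = a2 + b4 + b1" "b2 + (b1 - a1) = a2 + b3 + b2"
    "b3 + (b4 - a1) = b3 + (b2 - a2)"
    using mem_cross_planeD[OF X] by metis+
  have "Q' = (a1 + b2 + b3) *\<^sub>R X1 + (a2 + b3 + b4) *\<^sub>R X2 + (b4 + b1 - a1) *\<^sub>R X3 + (b1 + b2 - a2) *\<^sub>R X4"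
    by (simp add: Y1 Y2 Y3 Y4 algebra_simps)
  also have "a2 + b3 + b4 = a1 + b2 + b3" using e by simp
  also have "b4 + b1 - a1 = a1 + b2 + b3" using e by simp
  also have "b1 + b2 - a2 = a1 + b2 + b3" using e by simp
  finally show ?thesis using that[of "a1 + b2 + b3"] by (simp add: algebra_simps)
qed

text \<open>A dimension count: two distinct centres span dimension 2, and the planes differ by
  \<open>centre_eq_if\<close>, so their intersection has dimension at most 2.\<close>

lemma weingarten:
  assumes "\<nexists>k. Q' = k *\<^sub>R Q"
  shows "span {Q, Q'} = plane \<inter> plane'"
proof (rule subspace_dim_equal)
  have "Q \<in> plane" by (rule mem_cross_planeI[where r = 1 and s = 1 and t = 1 and u = 1]) auto
  moreover have "Q' \<in> plane'" by (rule mem_cross_planeI[where r = 1 and s = 1 and t = 1 and u = 1]) auto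
  ultimately show sub: "span {Q, Q'} \<subseteq> plane \<inter> plane'"
    using centre_mem centre'_mem by (intro span_minimal) (auto simp: subspace_inter)
  show si: "subspace (plane \<inter> plane')" by (simp add: subspace_inter)
  have "Q \<noteq> 0" using lin4D[OF X, of 1 1 1 1] by auto
  then have "independent {Q', Q}" "Q' \<noteq> Q"
    using assms by (auto simp: independent_insert span_singleton) (metis scaleR_one)
  then have "dim (span {Q, Q'}) = 2"
    by (simp add: dim_eq_card_independent insert_commute)
  moreover have "plane \<inter> plane' \<noteq> plane"
  proof
    assume "plane \<inter> plane' = plane"
    then have "plane = plane'"
      using cross_plane_dim[OF X] cross_plane_dim[OF Y]
      by (intro subspace_dim_equal) (auto simp: cross_plane_def)
    then show False using centre_eq_if assms by metis
  qed
  then have "dim (plane \<inter> plane') < dim plane"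
    using si by (intro dim_psubset) (simp add: cross_plane_def span_eq_iff[THEN iffD2] psubset_eq)
  ultimately show "dim (plane \<inter> plane') \<le> dim (span {Q, Q'})"
    using cross_plane_dim[OF X] by simp
qed auto

end

section \<open>Normalising an A-cube and its cross\<close>

lemma mod4: "(4::4) = 0" "(5::4) = 1" "(6::4) = 2" "(7::4) = 3"
  by simp_all

lemma minus_1_mod4: "i - 1 = i + 3" for i :: 4
  by (simp add: diff_eq_eq add.assoc mod4)

text \<open>The product condition is what closes the recursion for \<open>s\<close> after one turn.
  It serves twice: for the \<open>X\<close> along the cross, and for the \<open>Y\<close>.\<close>

lemma cyclic_scaling:
  fixes m :: "4 \<Rightarrow> real"
  assumes "\<And>i. m i \<noteq> 0" "m 1 * m 2 * m 3 * m 4 = 1"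
  obtains s where "\<And>i. s i \<noteq> 0" "\<And>i. s (i + 1) = m i * s i"
proof -
  define s :: "4 \<Rightarrow> real" where "s = (\<lambda>i. if i = 1 then 1 else if i = 2 then m 1 else
    if i = 3 then m 1 * m 2 else m 1 * m 2 * m 3)"
  have "\<forall>i. s (i + 1) = m i * s i"
    using assms(2) unfolding forall_4 s_def by (simp add: mult_ac)
  moreover have "\<forall>i. s i \<noteq> 0" using assms(1) by (simp add: s_def)
  ultimately show ?thesis using that by blast
qed

text \<open>One direction of the Menelaus theorem for a skew quadrilateral, in contrapositive
  form.\<close>

lemma cyclic_lin4:
  assumes "lin4 A B C D" "k * l * m * n \<noteq> 1"
  shows "lin4 (A + k *\<^sub>R B) (B + l *\<^sub>R C) (C + m *\<^sub>R D) (D + n *\<^sub>R A)"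
  unfolding lin4_def
proof (intro allI impI)
  fix r s t u
  assume "r *\<^sub>R (A + k *\<^sub>R B) + s *\<^sub>R (B + l *\<^sub>R C) + t *\<^sub>R (C + m *\<^sub>R D) + u *\<^sub>R (D + n *\<^sub>R A) = 0"
  then have "(r + n * u) *\<^sub>R A + (s + k * r) *\<^sub>R B + (t + l * s) *\<^sub>R C + (u + m * t) *\<^sub>R D = 0"
    by (simp add: algebra_simps)
  note c = lin4D[OF assms(1) this]
  have r: "r = - (n * u)" and s: "s = - (k * r)" and t: "t = - (l * s)" and u: "u = - (m * t)"
    using c by linarith+
  have "r * (k * l * m * n - 1) = 0" using r s t u by algebra
  then have "r = 0" using assms(2) by simp
  then show "r = 0 \<and> s = 0 \<and> t = 0 \<and> u = 0" using s t u by simp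
qed

text \<open>Being different from both vertices makes both coefficients nonzero. The point at
  infinity of the edge is the case \<open>m = -1\<close>.\<close>

lemma cross_edge:
  assumes "hline P \<subseteq> inc {aff x, aff y}" "P \<noteq> aff x" "P \<noteq> aff y"
  obtains m where "m \<noteq> 0" "P = pt ((x, 1) + m *\<^sub>R (y, 1))"
proof -
  obtain v where v: "v \<noteq> 0" "P = pt v" by (rule rp3_cases)
  have nz: "(x, 1::real) \<noteq> 0" "(y, 1::real) \<noteq> 0" by (simp_all add: zero_prod_def)
  have "v \<in> span {(x, 1), (y, 1)}"
    using assms(1) v nz unfolding aff_eq_pt by (auto simp: inc_pts intro: span_base)
  then obtain r s where rs: "v = r *\<^sub>R (x, 1) + s *\<^sub>R (y, 1)" unfolding mem_span2 by blast
  have "r \<noteq> 0"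
  proof
    assume "r = 0"
    with rs v have "s \<noteq> 0" "v = s *\<^sub>R (y, 1)" by (auto simp: zero_prod_def)
    then have "P = aff y" using pt_scale v(2) aff_eq_pt by metis
    with assms show False by blast
  qed
  moreover have "s \<noteq> 0"
  proof
    assume "s = 0"
    with rs v have "r \<noteq> 0" "v = r *\<^sub>R (x, 1)" by (auto simp: zero_prod_def)
    then have "P = aff x" using pt_scale v(2) aff_eq_pt by metis
    with assms show False by blast
  qed
  moreover have "v = r *\<^sub>R ((x, 1) + (s / r) *\<^sub>R (y, 1))"
    unfolding rs using \<open>r \<noteq> 0\<close> by (simp add: algebra_simps)
  ultimately show ?thesis using that[of "s / r"] v(2) pt_scale by (metis divide_eq_0_iff)
qed

lemma lin4_orthogonal:
  fixes A :: "'a::euclidean_space"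
  assumes "lin4 A B C D" "DIM('a) = 4" "N \<bullet> A = 0" "N \<bullet> B = 0" "N \<bullet> C = 0" "N \<bullet> D = 0"
  shows "N = 0"
proof -
  obtain a b c d where "N = a *\<^sub>R A + b *\<^sub>R B + c *\<^sub>R C + d *\<^sub>R D"
    using lin4_span[OF assms(1,2)] by blast
  then have "N \<bullet> N = a * (N \<bullet> A) + b * (N \<bullet> B) + c * (N \<bullet> C) + d * (N \<bullet> D)"
    by (metis inner_add_right inner_scaleR_right)
  then show ?thesis using assms by simp
qed

section \<open>Coordinates of the second face with respect to the first\<close>

lemma cube_coordinates:
  fixes X Y :: "4 \<Rightarrow> 'a::euclidean_space"
  assumes dim: "DIM('a) = 4"
    and X: "lin4 (X 1) (X 2) (X 3) (X 4)"
    and face: "\<And>i. lin4 (X i) (X (i + 1)) (Y (i + 1)) (Y i)"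
    and starX: "\<And>i. \<exists>N. N \<noteq> 0 \<and> N \<bullet> X i = 0 \<and> N \<bullet> X (i + 3) = 0 \<and> N \<bullet> X (i + 1) = 0 \<and> N \<bullet> Y i = 0"
    and starY: "\<And>i. \<exists>N. N \<noteq> 0 \<and> N \<bullet> Y i = 0 \<and> N \<bullet> Y (i + 3) = 0 \<and> N \<bullet> Y (i + 1) = 0 \<and> N \<bullet> X i = 0"
  obtains a b c where "\<And>i. Y i = a i *\<^sub>R X i + b i *\<^sub>R X (i + 3) + c i *\<^sub>R X (i + 1)"
    "\<And>i. b i \<noteq> 0" "\<And>i. c i \<noteq> 0"
    "\<And>i. b i * b (i + 3) * a (i + 1) + c i * c (i + 1) * a (i + 3) = 0"
proof -
  have "\<forall>i. lin4 (X i) (X (i + 1)) (X (i + 2)) (X (i + 3))"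
    unfolding forall_4 using X lin4_rotate by (simp add: mod4) blast
  then have Xi: "lin4 (X i) (X (i + 1)) (X (i + 2)) (X (i + 3))" for i by blast
  have "\<exists>a b c. Y i = a *\<^sub>R X i + b *\<^sub>R X (i + 3) + c *\<^sub>R X (i + 1)" for i
  proof -
    obtain N where N: "N \<noteq> 0" "N \<bullet> X i = 0" "N \<bullet> X (i + 3) = 0" "N \<bullet> X (i + 1) = 0" "N \<bullet> Y i = 0"
      using starX by blast
    \<comment> \<open>The plane of the star contains three basis points, so it misses the fourth;
      the coefficient of \<open>Y i\<close> there must vanish.\<close>
    have n: "N \<bullet> X (i + 2) \<noteq> 0" using lin4_orthogonal[OF Xi dim] N by blast
    obtain a c d b where Y: "Y i = a *\<^sub>R X i + c *\<^sub>R X (i + 1) + d *\<^sub>R X (i + 2) + b *\<^sub>R X (i + 3)"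
      using lin4_span[OF Xi dim] by blast
    then have "d * (N \<bullet> X (i + 2)) = 0" using N by (simp add: inner_simps)
    then have "Y i = a *\<^sub>R X i + b *\<^sub>R X (i + 3) + c *\<^sub>R X (i + 1)" using Y n by simp
    then show ?thesis by blast
  qed
  then obtain a b c where Yi: "\<And>i. Y i = a i *\<^sub>R X i + b i *\<^sub>R X (i + 3) + c i *\<^sub>R X (i + 1)"
    by metis
  have Yi': "Y (i + 1) = a (i + 1) *\<^sub>R X (i + 1) + b (i + 1) *\<^sub>R X i + c (i + 1) *\<^sub>R X (i + 2)"
    "Y (i + 3) = a (i + 3) *\<^sub>R X (i + 3) + b (i + 3) *\<^sub>R X (i + 2) + c (i + 3) *\<^sub>R X i" for i
    using Yi[of "i + 1"] Yi[of "i + 3"] by (simp_all add: add.assoc mod4)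
  have bnz: "b i \<noteq> 0" for i
  proof
    \<comment> \<open>Then \<open>Y i\<close> would lie on the line of \<open>X i\<close> and
      \<open>X (i + 1)\<close>, against skewness of the side face.\<close>
    assume "b i = 0"
    then have "(- a i) *\<^sub>R X i + (- c i) *\<^sub>R X (i + 1) + 0 *\<^sub>R Y (i + 1) + 1 *\<^sub>R Y i = 0"
      using Yi[of i] by simp
    from lin4D(4)[OF face this] show False by simp
  qed
  have cnz: "c i \<noteq> 0" for i
  proof -
    have "c (j + 1) \<noteq> 0" for j
    proof
      assume "c (j + 1) = 0"
      then have "(- b (j + 1)) *\<^sub>R X j + (- a (j + 1)) *\<^sub>R X (j + 1) + 1 *\<^sub>R Y (j + 1) + 0 *\<^sub>R Y j = 0"
        using Yi'(1)[of j] by simp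
      from lin4D(3)[OF face this] show False by simp
    qed
    from this[of "i - 1"] show ?thesis by simp
  qed
  have "b i * b (i + 3) * a (i + 1) + c i * c (i + 1) * a (i + 3) = 0" for i
  proof -
    obtain N where N: "N \<noteq> 0" "N \<bullet> Y i = 0" "N \<bullet> Y (i + 3) = 0" "N \<bullet> Y (i + 1) = 0" "N \<bullet> X i = 0"
      using starY by blast
    \<comment> \<open>A homogeneous system in the values of \<open>N\<close> at the three points
      other than \<open>X i\<close>. It has a nonzero solution, and the claimed relation is its
      vanishing determinant up to sign.\<close>
    have e: "b i * (N \<bullet> X (i + 3)) + c i * (N \<bullet> X (i + 1)) = 0"
      "a (i + 3) * (N \<bullet> X (i + 3)) + b (i + 3) * (N \<bullet> X (i + 2)) = 0"
      "a (i + 1) * (N \<bullet> X (i + 1)) + c (i + 1) * (N \<bullet> X (i + 2)) = 0"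
      using N unfolding Yi[of i] Yi' by (simp_all add: inner_simps)
    have "N \<bullet> X (i + 3) \<noteq> 0"
    proof
      assume "N \<bullet> X (i + 3) = 0"
      moreover from this have "N \<bullet> X (i + 1) = 0" "N \<bullet> X (i + 2) = 0"
        using e bnz cnz by auto
      ultimately show False using lin4_orthogonal[OF Xi dim] N by blast
    qed
    moreover have "(b i * b (i + 3) * a (i + 1) + c i * c (i + 1) * a (i + 3)) * (N \<bullet> X (i + 3)) = 0"
      using e by algebra
    ultimately show ?thesis by simp
  qed
  with Yi bnz cnz show ?thesis using that by blast
qed

text \<open>The relations at \<open>j\<close> and \<open>j + 2\<close> form a linear system in
  \<open>a (j + 1)\<close>, \<open>a (j + 3)\<close> whose determinant is the difference of the
  products; a nonzero unknown makes it vanish.\<close>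

lemma coordinate_products:
  fixes a b c :: "4 \<Rightarrow> real"
  assumes rel: "\<And>i. b i * b (i + 3) * a (i + 1) + c i * c (i + 1) * a (i + 3) = 0"
    and nz: "\<And>i. b i \<noteq> 0" "\<And>i. c i \<noteq> 0" and "a i \<noteq> 0"
  shows "b 1 * b 2 * b 3 * b 4 = c 1 * c 2 * c 3 * c 4"
proof -
  have "(b j * b (j + 1) * b (j + 2) * b (j + 3) - c j * c (j + 1) * c (j + 2) * c (j + 3)) * a (j + 1) = 0" for j
    using rel[of j] rel[of "j + 2"] by (simp add: add.assoc mod4) algebra
  from this[of "i - 1"] have
    "b (i - 1) * b (i - 1 + 1) * b (i - 1 + 2) * b (i - 1 + 3) =
     c (i - 1) * c (i - 1 + 1) * c (i - 1 + 2) * c (i - 1 + 3)" (is "?P (i - 1)")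
    using assms(4) by simp
  moreover have "\<forall>j. ?P j \<longrightarrow> b 1 * b 2 * b 3 * b 4 = c 1 * c 2 * c 3 * c 4"
    unfolding forall_4 by (simp add: mod4 mult_ac)
  ultimately show ?thesis by blast
qed

lemma lin4_cyclic:
  assumes "lin4 A B C D"
  shows "lin4 A B C D" "lin4 B C D A" "lin4 C D A B" "lin4 D A B C"
  using assms lin4_rotate by blast+

section \<open>Choice of the scalings\<close>

lemma cross_normal_form:
  assumes "lin4 (x 1, 1::real) (x 2, 1) (x 3, 1) (x 4, 1)" "is_cross x p"
  obtains s where "\<And>i. s i \<noteq> 0"
    "\<And>i. p i = pt (s i *\<^sub>R (x i, 1) + s (i + 1) *\<^sub>R (x (i + 1), 1))"
proof -
  have "\<exists>m. m \<noteq> 0 \<and> p i = pt ((x i, 1) + m *\<^sub>R (x (i + 1), 1))" for i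
    using assms(2) unfolding is_cross_def by (meson cross_edge)
  then obtain m where m: "\<And>i. m i \<noteq> 0" "\<And>i. p i = pt ((x i, 1) + m i *\<^sub>R (x (i + 1), 1))"
    by metis
  define R where "R i = (x i, 1::real) + m i *\<^sub>R (x (i + 1), 1)" for i
  have "\<forall>i. lin4 (x i, 1::real) (x (i + 1), 1) (x (i + 2), 1) (x (i + 3), 1)"
    unfolding forall_4 using lin4_cyclic[OF assms(1)] by (simp add: mod4)
  then have li: "lin4 (x i, 1::real) (x (i + 1), 1) (x (i + 2), 1) (x (i + 3), 1)" for i
    by blast
  have Rnz: "R i \<noteq> 0" for i
  proof
    assume "R i = 0"
    then have "1 *\<^sub>R (x i, 1::real) + m i *\<^sub>R (x (i + 1), 1) + 0 *\<^sub>R (x (i + 2), 1) + 0 *\<^sub>R (x (i + 3), 1) = 0"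
      by (simp add: R_def zero_prod_def)
    from lin4D(1)[OF li this] show False by simp
  qed
  have "dim (span {R 1, R 2, R 3, R 4}) \<le> 3"
    using assms(2) m(2) Rnz unfolding is_cross_def R_def[symmetric] by (simp add: inc_pts)
  moreover have "R 1 = (x 1, 1) + m 1 *\<^sub>R (x 2, 1)" "R 2 = (x 2, 1) + m 2 *\<^sub>R (x 3, 1)"
    "R 3 = (x 3, 1) + m 3 *\<^sub>R (x 4, 1)" "R 4 = (x 4, 1) + m 4 *\<^sub>R (x 1, 1)"
    by (simp_all add: R_def mod4)
  ultimately have "m 1 * m 2 * m 3 * m 4 = 1"
    using not_lin4_if_dim_le cyclic_lin4[OF assms(1)] by metis
  then obtain s where s: "\<And>i. s i \<noteq> 0" "\<And>i. s (i + 1) = m i * s i"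
    using cyclic_scaling[of m] m(1) by blast
  have "p i = pt (s i *\<^sub>R R i)" for i
    unfolding pt_scale[OF s(1)] m(2) R_def ..
  then have "p i = pt (s i *\<^sub>R (x i, 1) + s (i + 1) *\<^sub>R (x (i + 1), 1))" for i
    unfolding R_def s(2) by (simp add: scaleR_add_right mult.commute del: scaleR_Pair)
  with s(1) show ?thesis using that by blast
qed

lemma A_cube_normal_form:
  assumes "A_cube x x'" "\<not> two_line_cube x x'" and s: "\<And>i. s i \<noteq> 0"
    and X_def: "X = (\<lambda>i. s i *\<^sub>R (x i, 1::real))"
  obtains t a b where "\<And>i. t i \<noteq> 0"
    "lin4 (X 1) (X 2) (X 3) (X 4)"
    "lin4 (t 1 *\<^sub>R (x' 1, 1::real)) (t 2 *\<^sub>R (x' 2, 1)) (t 3 *\<^sub>R (x' 3, 1)) (t 4 *\<^sub>R (x' 4, 1))"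
    "\<And>i. t i *\<^sub>R (x' i, 1) = a i *\<^sub>R X i + b i *\<^sub>R X (i + 3) + b (i + 3) *\<^sub>R X (i + 1)"
    "\<And>i. a (i + 2) = - a i" "\<And>i. b i \<noteq> 0"
proof -
  define Y where "Y = (\<lambda>i. (x' i, 1::real))"
  have dim: "DIM((real^3) \<times> real) = 4" by simp
  have X: "lin4 (X 1) (X 2) (X 3) (X 4)"
    unfolding X_def using assms(1) s by (intro lin4_scale lin4_hom) (auto simp: A_cube_def)
  have Y: "lin4 (Y 1) (Y 2) (Y 3) (Y 4)"
    unfolding Y_def using assms(1) by (intro lin4_hom) (auto simp: A_cube_def)
  have face: "lin4 (X i) (X (i + 1)) (Y (i + 1)) (Y i)" for i
  proof -
    have "lin4 (x i, 1::real) (x (i + 1), 1) (x' (i + 1), 1) (x' i, 1)"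
      using assms(1) by (intro lin4_hom) (auto simp: A_cube_def)
    from lin4_scale[OF this s s, of 1 1] show ?thesis by (simp add: X_def Y_def)
  qed
  have starX: "\<exists>N. N \<noteq> 0 \<and> N \<bullet> X i = 0 \<and> N \<bullet> X (i + 3) = 0 \<and> N \<bullet> X (i + 1) = 0 \<and> N \<bullet> Y i = 0" for i
  proof -
    have "planar_star (x i) (x (i + 3)) (x (i + 1)) (x' i)"
      using assms(1) by (auto simp: A_cube_def minus_1_mod4)
    then obtain N :: "(real^3) \<times> real" where "N \<noteq> 0" "N \<bullet> (x i, 1) = 0" "N \<bullet> (x (i + 3), 1) = 0"
      "N \<bullet> (x (i + 1), 1) = 0" "N \<bullet> (x' i, 1) = 0"
      using planar_star_hom by blast
    then show ?thesis
      by (intro exI[of _ N]) (simp add: X_def Y_def del: scaleR_Pair inner_Pair)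
  qed
  have starY: "\<exists>N. N \<noteq> 0 \<and> N \<bullet> Y i = 0 \<and> N \<bullet> Y (i + 3) = 0 \<and> N \<bullet> Y (i + 1) = 0 \<and> N \<bullet> X i = 0" for i
  proof -
    have "planar_star (x' i) (x' (i + 3)) (x' (i + 1)) (x i)"
      using assms(1) by (auto simp: A_cube_def minus_1_mod4)
    then obtain N :: "(real^3) \<times> real" where "N \<noteq> 0" "N \<bullet> (x' i, 1) = 0" "N \<bullet> (x' (i + 3), 1) = 0"
      "N \<bullet> (x' (i + 1), 1) = 0" "N \<bullet> (x i, 1) = 0"
      using planar_star_hom by blast
    then show ?thesis
      by (intro exI[of _ N]) (simp add: X_def Y_def del: scaleR_Pair inner_Pair)
  qed
  obtain a b c where Yc: "\<And>i. Y i = a i *\<^sub>R X i + b i *\<^sub>R X (i + 3) + c i *\<^sub>R X (i + 1)"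
    and nz: "\<And>i. b i \<noteq> 0" "\<And>i. c i \<noteq> 0"
    and rel: "\<And>i. b i * b (i + 3) * a (i + 1) + c i * c (i + 1) * a (i + 3) = 0"
    by (rule cube_coordinates[OF dim X face starX starY]) blast
  have "\<exists>i. a i \<noteq> 0"
  \<comment> \<open>If all \<open>a i\<close> vanish, each \<open>Y i\<close> lies on the diagonal
    through \<open>X (i + 3)\<close> and \<open>X (i + 1)\<close>, so the colour classes lie on the
    two diagonals.\<close>
  proof (rule ccontr)
    assume "\<nexists>i. a i \<noteq> 0"
    then have "Y i = (b i * s (i + 3)) *\<^sub>R (x (i + 3), 1) + (c i * s (i + 1)) *\<^sub>R (x (i + 1), 1)" for i
      using Yc[of i] by (simp add: X_def)
    then have mem: "x' i \<in> affine hull {x (i + 3), x (i + 1)}" for i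
      unfolding Y_def by (rule mem_affine_hull_hom)
    have "{x 1, x 3, x' 2, x' 4} \<subseteq> affine hull {x 1, x 3}"
      using mem[of 2] mem[of 4] by (simp add: hull_inc mod4 insert_commute)
    moreover have "{x 2, x 4, x' 1, x' 3} \<subseteq> affine hull {x 2, x 4}"
      using mem[of 1] mem[of 3] by (simp add: hull_inc mod4 insert_commute)
    ultimately have "two_line_cube x x'"
      unfolding two_line_cube_def collinear_affine_hull by blast
    with assms show False by blast
  qed
  then have prod: "b 1 * b 2 * b 3 * b 4 = c 1 * c 2 * c 3 * c 4"
    using coordinate_products[OF rel nz] by blast
  \<comment> \<open>The scaling \<open>t\<close> is to satisfy
    \<open>t (i + 1) * c (i + 1) = t i * b i\<close>; the equal products close this cyclic
    recursion.\<close>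
  have "b 1 / c 2 * (b 2 / c 3) * (b 3 / c 4) * (b 4 / c 1) = 1"
    using prod nz by (simp add: field_simps)
  then obtain t where t: "\<And>i. t i \<noteq> 0" "\<And>i. t (i + 1) = b i / c (i + 1) * t i"
    using cyclic_scaling[of "\<lambda>i. b i / c (i + 1)"] nz by (auto simp: mod4)
  have tc: "t (i + 1) * c (i + 1) = t i * b i" for i
    using t(2)[of i] nz by (simp add: field_simps)
  have tc': "t i * c i = t (i + 3) * b (i + 3)" for i
    using tc[of "i + 3"] by (simp add: add.assoc mod4)
  show ?thesis
  proof (rule that[of t "\<lambda>i. t i * a i" "\<lambda>i. t i * b i"])
    show "lin4 (t 1 *\<^sub>R (x' 1, 1::real)) (t 2 *\<^sub>R (x' 2, 1)) (t 3 *\<^sub>R (x' 3, 1)) (t 4 *\<^sub>R (x' 4, 1))"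
      using lin4_scale[OF Y t(1) t(1) t(1) t(1)] by (simp add: Y_def)
    show "t i *\<^sub>R (x' i, 1) = (t i * a i) *\<^sub>R X i + (t i * b i) *\<^sub>R X (i + 3) + (t (i + 3) * b (i + 3)) *\<^sub>R X (i + 1)" for i
    proof -
      have "t i *\<^sub>R Y i = (t i * a i) *\<^sub>R X i + (t i * b i) *\<^sub>R X (i + 3) + (t i * c i) *\<^sub>R X (i + 1)"
        unfolding Yc[of i] by (simp add: scaleR_add_right)
      then show ?thesis unfolding tc' by (simp add: Y_def)
    qed
    have opp: "t (j + 1) * a (j + 1) = - (t (j + 3) * a (j + 3))" for j
    proof -
      \<comment> \<open>This is the relation at \<open>j\<close> multiplied by
        \<open>t j * t (j + 1) * t (j + 3)\<close>.\<close>
      have "(t j * b j) * (t (j + 3) * b (j + 3)) * (t (j + 1) * a (j + 1) + t (j + 3) * a (j + 3)) = 0"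
        using rel[of j] tc[of j] tc'[of j] by algebra
      then show ?thesis using t(1) nz by (simp add: eq_neg_iff_add_eq_0)
    qed
    show "t (i + 2) * a (i + 2) = - (t i * a i)" for i
      using opp[of "i + 1"] by (simp add: add.assoc mod4)
  qed (use t nz X in auto)
qed

section \<open>From the normalised coordinates back to crosses in projective space\<close>

theorem theorem31:
  fixes x x' :: "4 \<Rightarrow> real^3" and p :: "4 \<Rightarrow> rp3"
  assumes "A_cube x x'"
    and "\<not> two_line_cube x x'"
    and "is_cross x p"
  shows "(\<exists>!p'. C1_propagation x' p p') \<and>
         (\<forall>p'. C1_propagation x' p p' \<longrightarrow>
            is_cross x' p' \<and>
            (\<exists>q q'. is_centre p q \<and> is_centre p' q' \<and>
               (\<not> (q = q' \<and> inc {p 1, p 2, p 3, p 4} = inc {p' 1, p' 2, p' 3, p' 4}) \<longrightarrow>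
                inc {q, q'} = inc {p 1, p 2, p 3, p 4} \<inter> inc {p' 1, p' 2, p' 3, p' 4})))"
proof -
  have "lin4 (x 1, 1::real) (x 2, 1) (x 3, 1) (x 4, 1)"
    using assms(1) by (intro lin4_hom) (auto simp: A_cube_def)
  then obtain s where s: "\<And>i. s i \<noteq> 0"
    "\<And>i. p i = pt (s i *\<^sub>R (x i, 1) + s (i + 1) *\<^sub>R (x (i + 1), 1))"
    using cross_normal_form assms(3) by metis
  define X where "X = (\<lambda>i. s i *\<^sub>R (x i, 1::real))"
  obtain t a b where t: "\<And>i. t i \<noteq> 0" and lX: "lin4 (X 1) (X 2) (X 3) (X 4)"
    and lY: "lin4 (t 1 *\<^sub>R (x' 1, 1::real)) (t 2 *\<^sub>R (x' 2, 1)) (t 3 *\<^sub>R (x' 3, 1)) (t 4 *\<^sub>R (x' 4, 1))"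
    and co: "\<And>i. t i *\<^sub>R (x' i, 1) = a i *\<^sub>R X i + b i *\<^sub>R X (i + 3) + b (i + 3) *\<^sub>R X (i + 1)"
    and ab: "\<And>i. a (i + 2) = - a i" "\<And>i. b i \<noteq> 0"
    by (rule A_cube_normal_form[OF assms(1,2) s(1) X_def]) blast
  define Y where "Y = (\<lambda>i. t i *\<^sub>R (x' i, 1::real))"
  have lY: "lin4 (Y 1) (Y 2) (Y 3) (Y 4)" using lY by (simp add: Y_def)
  have Yi: "Y i = a i *\<^sub>R X i + b i *\<^sub>R X (i + 3) + b (i + 3) *\<^sub>R X (i + 1)" for i
    using co[of i] by (simp only: Y_def)
  have p: "p i = pt (X i + X (i + 1))" for i
    using s(2) by (simp only: X_def)
  have x': "aff (x' i) = pt (Y i)" for i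
    unfolding Y_def pt_scale[OF t] aff_eq_pt ..
  have a34: "a 3 = - a 1" "a 4 = - a 2" using ab(1)[of 1] ab(1)[of 2] by simp_all
  interpret normal_cube "X 1" "X 2" "X 3" "X 4" "Y 1" "Y 2" "Y 3" "Y 4" "a 1" "a 2" "b 1" "b 2" "b 3" "b 4"
  proof
    show "Y 1 = a 1 *\<^sub>R X 1 + b 1 *\<^sub>R X 4 + b 4 *\<^sub>R X 2" using Yi[of 1] by simp
    show "Y 2 = a 2 *\<^sub>R X 2 + b 2 *\<^sub>R X 1 + b 1 *\<^sub>R X 3" using Yi[of 2] by (simp add: mod4)
    show "Y 3 = - a 1 *\<^sub>R X 3 + b 3 *\<^sub>R X 2 + b 2 *\<^sub>R X 4" using Yi[of 3] a34 by (simp add: mod4)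
    show "Y 4 = - a 2 *\<^sub>R X 4 + b 4 *\<^sub>R X 3 + b 3 *\<^sub>R X 1"
      using Yi[of 4] a34 by (simp add: mod4)
  qed (fact lX lY ab(2))+
  \<comment> \<open>Three successive index shifts provide the remaining cyclic choices of the
    propagation.\<close>
  note c2 = rotate
  note c3 = normal_cube.rotate[OF c2]
  note c4 = normal_cube.rotate[OF c3]
  have "\<forall>i. span {X i + X (i + 1), Y i, Y (i + 1)} \<inter> span {Y (i + 2), Y (i + 3)} = span {Y (i + 2) + Y (i + 3)}"
    unfolding forall_4
    using projection normal_cube.projection[OF c2] normal_cube.projection[OF c3] normal_cube.projection[OF c4]
    by (simp add: mod4)
  then have proj: "span {X i + X (i + 1), Y i, Y (i + 1)} \<inter> span {Y (i + 2), Y (i + 3)} = span {Y (i + 2) + Y (i + 3)}" for i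
    by blast
  have "\<forall>i. lin4 (X i) (X (i + 1)) (X (i + 2)) (X (i + 3))" "\<forall>i. lin4 (Y i) (Y (i + 1)) (Y (i + 2)) (Y (i + 3))"
    unfolding forall_4 using lin4_cyclic[OF lX] lin4_cyclic[OF lY] by (simp_all add: mod4)
  then have Xi: "lin4 (X i) (X (i + 1)) (X (i + 2)) (X (i + 3))"
    and Yi4: "lin4 (Y i) (Y (i + 1)) (Y (i + 2)) (Y (i + 3))" for i by blast+
  note nz = lin4_nonzero[OF Xi] lin4_nonzero[OF Yi4]
  define P' where "P' = (\<lambda>i. pt (Y i + Y (i + 1)))"
  have "C1_propagation x' p p' \<longleftrightarrow> (\<forall>i. hline (p' (i + 2)) = hline (P' (i + 2)))" for p'
  proof -
    have "inc {p i, aff (x' i), aff (x' (i + 1))} \<inter> inc {aff (x' (i + 2)), aff (x' (i + 3))} = hline (P' (i + 2))" for i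
      using nz nz(4)[of "i + 2"] unfolding p x' P'_def by (simp add: inc_pts proj add.assoc)
    then show ?thesis unfolding C1_propagation_def by simp
  qed
  moreover have "(\<forall>i. hline (p' (i + 2)) = hline (P' (i + 2))) \<longleftrightarrow> p' = P'" for p'
  proof
    assume *: "\<forall>i. hline (p' (i + 2)) = hline (P' (i + 2))"
    show "p' = P'"
    proof
      fix i
      \<comment> \<open>Every index has the form \<open>j + 2\<close>, so the propagation prescribes
        all four points.\<close>
      show "p' i = P' i" using *[rule_format, of "i - 2"] by (simp add: hline_inject)
    qed
  qed simp
  ultimately have C1: "C1_propagation x' p p' \<longleftrightarrow> p' = P'" for p'
    by blast
  have P1234: "P' 1 = pt (Y 1 + Y 2)" "P' 2 = pt (Y 2 + Y 3)" "P' 3 = pt (Y 3 + Y 4)" "P' 4 = pt (Y 4 + Y 1)"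
    "p 1 = pt (X 1 + X 2)" "p 2 = pt (X 2 + X 3)" "p 3 = pt (X 3 + X 4)" "p 4 = pt (X 4 + X 1)"
    by (simp_all add: P'_def p mod4)
  have nz4: "X 1 + X 2 \<noteq> 0" "X 2 + X 3 \<noteq> 0" "X 3 + X 4 \<noteq> 0" "X 4 + X 1 \<noteq> 0"
    "Y 1 + Y 2 \<noteq> 0" "Y 2 + Y 3 \<noteq> 0" "Y 3 + Y 4 \<noteq> 0" "Y 4 + Y 1 \<noteq> 0"
    using nz(2)[of 1] nz(2)[of 2] nz(2)[of 3] nz(2)[of 4] nz(4)[of 1] nz(4)[of 2] nz(4)[of 3] nz(4)[of 4]
    by (simp_all add: mod4)
  have planes: "inc {p 1, p 2, p 3, p 4} = cross_plane (X 1) (X 2) (X 3) (X 4)"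
    "inc {P' 1, P' 2, P' 3, P' 4} = cross_plane (Y 1) (Y 2) (Y 3) (Y 4)"
    unfolding P1234 cross_plane_def using nz4 by (simp_all add: inc_pts)
  have cross: "is_cross x' P'"
    unfolding is_cross_def planes(2)
  proof (intro conjI allI)
    fix i
    show "hline (P' i) \<subseteq> inc {aff (x' i), aff (x' (i + 1))}"
    proof -
      have "Y i + Y (i + 1) \<in> span {Y i, Y (i + 1)}" by (simp add: span_add span_base)
      moreover have "Y (i + 1) \<noteq> 0" by (rule nz)
      ultimately show ?thesis
        unfolding x' P'_def inc_pt2[OF nz(3) nz(3)] hline_pt[OF nz(4)] by (intro span_minimal) simp_all
    qed
    show "P' i \<noteq> aff (x' i)" "P' i \<noteq> aff (x' (i + 1))"
    proof -
      \<comment> \<open>A multiple of one vertex would force a coefficient 1 to be 0, against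
        independence.\<close>
      have "Y i + Y (i + 1) \<noteq> k *\<^sub>R Y i" "Y i + Y (i + 1) \<noteq> k *\<^sub>R Y (i + 1)" for k
        using lin4D(2)[OF Yi4[of i], of "1 - k" 1 0 0] lin4D(1)[OF Yi4[of i], of 1 "1 - k" 0 0]
        by (auto simp: algebra_simps)
      then show "P' i \<noteq> aff (x' i)" "P' i \<noteq> aff (x' (i + 1))"
        unfolding x' P'_def
        using pt_eq_iff[OF nz(3)[of i] nz(4)[of i]] pt_eq_iff[OF nz(3)[of "i + 1"] nz(4)[of i]] by force+
    qed
    show "dim (cross_plane (Y 1) (Y 2) (Y 3) (Y 4)) \<le> 3"
      using cross_plane_dim[OF lY] by simp
  qed
  have qnz: "Q \<noteq> 0" "Q' \<noteq> 0" using lin4D[OF lX, of 1 1 1 1] lin4D[OF lY, of 1 1 1 1] by auto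
  have "is_centre p (pt Q)" "is_centre P' (pt Q')"
    unfolding is_centre_def P1234 using nz4 qnz cross_centre[OF lX] cross_centre[OF lY]
    by (simp_all add: inc_pts)
  moreover have "inc {pt Q, pt Q'} = plane \<inter> plane'" if "\<not> (pt Q = pt Q' \<and> plane = plane')"
  proof -
    \<comment> \<open>Proportional centres would make both the centres and the planes coincide,
      which is exactly the excluded case.\<close>
    have "\<nexists>k. Q' = k *\<^sub>R Q"
    proof
      assume k: "\<exists>k. Q' = k *\<^sub>R Q"
      then have "pt Q = pt Q'" using pt_eq_iff[OF qnz] by blast
      moreover have "plane = plane'" using k planes_eq_if by blast
      ultimately show False using that by blast
    qed
    from weingarten[OF this] show ?thesis unfolding inc_pt2[OF qnz] .
  qed
  ultimately show ?thesis
    unfolding C1 planes(1)[symmetric] planes(2)[symmetric] using cross by blast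
qed

end
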